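(* Let $\mathfrak{A}$ be a unital JB$^*$-algebra, and let $p$ be a positive norm-one element in $\mathfrak{A}$. Then the following statements are equivalent: (a) $p$ is a projection in $\mathfrak{A}$. (b) $\mathrm{Sph}_{S_{\mathfrak{A}^+}}\left(\mathrm{Sph}_{S_{\mathfrak{A}^+}}(p)\right) = \{p\}$.
   Context: A JB$^*$-algebra is a complex Banach space $\mathfrak{A}$ with a bilinear commutative product $(a,b)\mapsto a\circ b$ satisfying $\|a\circ b\|\le\|a\|\,\|b\|$ and a (conjugate-linear) algebra involution $a\mapsto a^*$ such that (1) $(a\circ b)\circ b^2=(a\circ b^2)\circ b$ for all $a,b\in\mathfrak{A}$ (Jordan identity), and (2) $\|U_a(a^* )\|=\|a\|^3$ for all $a\in\mathfrak{A}$, where $U_a(b)=2(a\circ b)\circ a-a^2\circ b$. It is unital if there is $\mathbf{1}\in\mathfrak{A}$ with $\mathbf{1}\circ a=a$ for all $a\in\mathfrak{A}$. A projection is a self-adjoint idempotent ($p=p^*=p\circ p$). The positive cone is $\mathfrak{A}^+=\{h\circ h : h\in\mathfrak{A},\ h=h^*\}$, and $S_{\mathfrak{A}^+}=\{x\in\mathfrak{A}^+:\|x\|=1\}$. For subsets $\mathscr{S},P\subseteq\mathfrak{A}$, $\mathrm{Sph}_P(\mathscr{S}):=\{x\in P:\|x-s\|=1\text{ for all }s\in\mathscr{S}\}$ (so $\mathrm{Sph}_P(\emptyset)=P$), and $\mathrm{Sph}_P(a)$ means $\mathrm{Sph}_P(\{a\})$. *)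

theory Defs
  imports "HOL-Analysis.Analysis"
begin

class scaleC = scaleR +
  fixes scaleC :: "complex \<Rightarrow> 'a \<Rightarrow> 'a"  (infixr "*\<^sub>C" 75)
  assumes scaleR_scaleC: "scaleR r x = complex_of_real r *\<^sub>C x"

class complex_vector = scaleC + ab_group_add +
  assumes scaleC_add_right: "c *\<^sub>C (x + y) = c *\<^sub>C x + c *\<^sub>C y"
    and scaleC_add_left: "(c + d) *\<^sub>C x = c *\<^sub>C x + d *\<^sub>C x"
    and scaleC_scaleC: "c *\<^sub>C (d *\<^sub>C x) = (c * d) *\<^sub>C x"
    and scaleC_one: "1 *\<^sub>C x = x"

(* Linearity of the product in the second argument follows from commutativity. *)
class complex_jordan_algebra = complex_vector +
  fixes jprod :: "'a \<Rightarrow> 'a \<Rightarrow> 'a"  (infixl "\<odot>" 70)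
  assumes jprod_commute: "a \<odot> b = b \<odot> a"
    and jprod_add_left: "(a + b) \<odot> c = a \<odot> c + b \<odot> c"
    and jprod_scaleC_left: "(z *\<^sub>C a) \<odot> b = z *\<^sub>C (a \<odot> b)"
    and jordan_identity: "(a \<odot> b) \<odot> (b \<odot> b) = (a \<odot> (b \<odot> b)) \<odot> b"
begin

definition U_op :: "'a \<Rightarrow> 'a \<Rightarrow> 'a" where
  "U_op a b = 2 *\<^sub>C ((a \<odot> b) \<odot> a) - (a \<odot> a) \<odot> b"

end

class jordan_star_algebra = complex_jordan_algebra +
  fixes star :: "'a \<Rightarrow> 'a"
  assumes star_star: "star (star a) = a"
    and star_add: "star (a + b) = star a + star b"
    and star_scaleC: "star (z *\<^sub>C a) = cnj z *\<^sub>C star a"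
    and star_jprod: "star (a \<odot> b) = star a \<odot> star b"
begin

definition is_projection :: "'a \<Rightarrow> bool" where
  "is_projection p \<longleftrightarrow> star p = p \<and> p \<odot> p = p"

definition positive_cone :: "'a set" where
  "positive_cone = {h \<odot> h | h. star h = h}"

end

class jb_star_algebra = jordan_star_algebra + banach +
  assumes norm_scaleC: "norm (z *\<^sub>C a) = cmod z * norm a"
    and norm_jprod_le: "norm (a \<odot> b) \<le> norm a * norm b"
    and norm_U_op_star: "norm (U_op a (star a)) = norm a ^ 3"

class unital_jb_star_algebra = jb_star_algebra +
  assumes ex_unit: "\<exists>u. \<forall>a. u \<odot> a = a"

definition positive_unit_sphere :: "'a::jb_star_algebra set" where
  "positive_unit_sphere = {x \<in> positive_cone. norm x = 1}"

definition Sph :: "'a::real_normed_vector set \<Rightarrow> 'a set \<Rightarrow> 'a set" where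
  "Sph P S = {x \<in> P. \<forall>s\<in>S. norm (x - s) = 1}"

end

theory Submission
  imports Defs
begin

text \<open>
  The argument lives in the order of the self-adjoint part, where \<open>a \<le> b\<close> means that \<open>b - a\<close> is a
  square of a self-adjoint element. The link between norm and order is that \<open>norm a \<le> t\<close> holds for
  self-adjoint \<open>a\<close> exactly when \<open>-t \<le> a \<le> t\<close>, and this rests on two facts. A self-adjoint element
  within distance \<open>t\<close> of \<open>t\<close> times the unit is a square, because \<open>1 - c\<close> has a square root when
  \<open>norm c \<le> 1\<close> (\<open>sqrt_fixed_point\<close>, \<open>positive_cone_corner\<close>). Conversely, if \<open>norm (h \<odot> h) \<le> 1\<close>,
  then \<open>h\<close> is the real part of the unitary \<open>u = h + \<i> k\<close> with \<open>k\<close> a square root of \<open>1 - h\<^sup>2\<close>, and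
  \<open>2h\<^sup>2 - 1\<close>, the real part of \<open>u\<^sup>2\<close>, has norm at most one (\<open>norm_one_minus_double_square_le\<close>).
  Order inequalities then replace arguments with states.

  If the double sphere of \<open>p\<close> is \<open>{p}\<close>, then \<open>p\<close> is idempotent because \<open>p\<^sup>2\<close> belongs to that
  double sphere: the inequalities \<open>p\<^sup>2 \<le> p \<le> (1 + p\<^sup>2)/2\<close> show that a positive \<open>x\<close> of norm one at
  distance less than one from \<open>p\<^sup>2\<close> is also at distance less than one from \<open>p\<close>
  (\<open>square_mem_double_sphere\<close>).

  Conversely let \<open>p\<close> be a projection and let \<open>q\<close> lie in the double sphere. Take the Peirce
  decomposition \<open>q = q\<^sub>1 + z + q\<^sub>0\<close> with respect to \<open>p\<close>. If \<open>q\<^sub>0 \<noteq> 0\<close>, let \<open>y\<close> be \<open>q\<^sub>0\<close>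
  normalised; then \<open>(1 + y)/2\<close> lies in the sphere of \<open>p\<close>, but a state at which it and \<open>q\<close> differ
  by one would vanish at \<open>p\<close> and at \<open>q\<close> and be one at \<open>y\<close>, which is absurd as it must take the
  value \<open>norm q\<^sub>0\<close> at \<open>q\<close> (\<open>norm_diff_lt_one\<close> is the quantitative form without states). So
  \<open>q\<^sub>0 = 0\<close>. From \<open>q\<^sup>2 \<le> q\<close> it follows that \<open>z\<^sup>2\<close> lives under \<open>p\<close>, and the Jordan identity forces
  \<open>z\<^sup>3 = 0\<close>, hence \<open>z = 0\<close> (\<open>off_corner_zero\<close>). Thus \<open>0 \<le> q \<le> p\<close>. If \<open>b = p - q\<close> were nonzero,
  \<open>p - b / norm b\<close> would lie in the sphere of \<open>p\<close> at distance \<open>1 - norm b\<close> from \<open>q\<close>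
  (\<open>eq_of_corner\<close>).
\<close>

section \<open>The product, the involution and the unit\<close>

lemma star_zero [simp]: "star (0::'a::jordan_star_algebra) = 0"
  by (metis add_cancel_left_left star_add)

lemma bounded_bilinear_jprod:
  "bounded_bilinear ((\<odot>) :: 'a::jb_star_algebra \<Rightarrow> 'a \<Rightarrow> 'a)"
proof
  fix a a' b b' :: 'a and r :: real
  show "(a + a') \<odot> b = a \<odot> b + a' \<odot> b" by (rule jprod_add_left)
  then show "a \<odot> (b + b') = a \<odot> b + a \<odot> b'"
    by (metis jprod_add_left jprod_commute)
  show "(r *\<^sub>R a) \<odot> b = r *\<^sub>R (a \<odot> b)"
    by (simp add: scaleR_scaleC jprod_scaleC_left)
  then show "a \<odot> (r *\<^sub>R b) = r *\<^sub>R (a \<odot> b)"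
    by (metis jprod_scaleC_left jprod_commute scaleR_scaleC)
  show "\<exists>K. \<forall>a b :: 'a. norm (a \<odot> b) \<le> norm a * norm b * K"
    by (rule exI[of _ 1]) (simp add: norm_jprod_le)
qed

interpretation jprod: bounded_bilinear "(\<odot>) :: 'a::jb_star_algebra \<Rightarrow> 'a \<Rightarrow> 'a"
  by (rule bounded_bilinear_jprod)

lemmas jprod_linear = jprod.add_left jprod.add_right jprod.diff_left jprod.diff_right
  jprod.minus_left jprod.minus_right jprod.zero_left jprod.zero_right jprod.scaleR_left jprod.scaleR_right

text \<open>
  The Jordan identity is cubic in \<open>b\<close>. Substituting \<open>b + c\<close> and \<open>b - c\<close> isolates the part that is
  linear in \<open>c\<close>; the name \<open>Y\<close> is for the part linear in \<open>b\<close>.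
\<close>

lemma jordan_identity_linear:
  fixes a b c :: "'a::jb_star_algebra"
  shows "2 *\<^sub>R ((a \<odot> b) \<odot> (b \<odot> c)) + (a \<odot> c) \<odot> (b \<odot> b)
       = 2 *\<^sub>R ((a \<odot> (b \<odot> c)) \<odot> b) + (a \<odot> (b \<odot> b)) \<odot> c"
proof -
  define X where "X = 2 *\<^sub>R ((a \<odot> b) \<odot> (b \<odot> c)) + (a \<odot> c) \<odot> (b \<odot> b)
       - (2 *\<^sub>R ((a \<odot> (b \<odot> c)) \<odot> b) + (a \<odot> (b \<odot> b)) \<odot> c)"
  define Y where "Y = 2 *\<^sub>R ((a \<odot> c) \<odot> (b \<odot> c)) + (a \<odot> b) \<odot> (c \<odot> c)
       - (2 *\<^sub>R ((a \<odot> (b \<odot> c)) \<odot> c) + (a \<odot> (c \<odot> c)) \<odot> b)"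
  have 1: "X + Y = 0"
    using jordan_identity[of a "b + c"] jordan_identity[of a b] jordan_identity[of a c]
      jprod_commute[of c b]
    by (simp add: X_def Y_def jprod_linear scaleR_2 algebra_simps)
  have 2: "Y - X = 0"
    using jordan_identity[of a "b - c"] jordan_identity[of a b] jordan_identity[of a c]
      jprod_commute[of c b]
    by (simp add: X_def Y_def jprod_linear scaleR_2 algebra_simps)
  from 1 2 have "2 *\<^sub>R X = 0" by (simp add: scaleR_2)
  then show ?thesis by (simp add: X_def)
qed

text \<open>
  Polarisation of the previous identity, whose defect \<open>D u\<close> is quadratic in \<open>u\<close>.
\<close>

lemma jordan_identity_multilinear:
  fixes a b c d :: "'a::jb_star_algebra"
  shows "(a \<odot> b) \<odot> (c \<odot> d) + (a \<odot> c) \<odot> (b \<odot> d) + (a \<odot> d) \<odot> (b \<odot> c)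
       = (a \<odot> (c \<odot> d)) \<odot> b + (a \<odot> (b \<odot> d)) \<odot> c + (a \<odot> (b \<odot> c)) \<odot> d"
    (is "?l = ?r")
proof -
  define D where "D u = 2 *\<^sub>R ((a \<odot> u) \<odot> (u \<odot> d)) + (a \<odot> d) \<odot> (u \<odot> u)
       - (2 *\<^sub>R ((a \<odot> (u \<odot> d)) \<odot> u) + (a \<odot> (u \<odot> u)) \<odot> d)" for u
  have "D u = 0" for u by (simp add: D_def jordan_identity_linear)
  then have "D (b + c) - D b - D c = 0" by simp
  moreover have "D (b + c) - D b - D c = 2 *\<^sub>R (?l - ?r)"
    using jprod_commute[of c b]
    by (simp add: D_def jprod_linear scaleR_2 algebra_simps)
  ultimately show ?thesis by simp
qed

text \<open>
  For self-adjoint \<open>a\<close> the element \<open>U_op a (star a)\<close> is the cube of \<open>a\<close>. In particular a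
  self-adjoint element with zero cube is zero.
\<close>

lemma U_op_star_self_adjoint:
  fixes a :: "'a::jb_star_algebra"
  assumes "star a = a"
  shows "norm ((a \<odot> a) \<odot> a) = norm a ^ 3"
proof -
  have "U_op a (star a) = (a \<odot> a) \<odot> a"
    using assms scaleR_scaleC[of 2 "(a \<odot> a) \<odot> a", symmetric] by (simp add: U_op_def scaleR_2)
  then show ?thesis using norm_U_op_star[of a] by simp
qed

text \<open>
  The involution is in fact isometric, but continuity suffices below, to keep limits of
  self-adjoint elements self-adjoint. It follows from expanding \<open>U_op\<close> in the norm axiom at
  \<open>star a\<close>.
\<close>

lemma norm_star_le: "norm (star a) \<le> 3 * norm (a::'a::jb_star_algebra)"
proof -
  have "norm (star b) ^ 3 \<le> 3 * norm (star b) ^ 2 * norm b" for b :: 'a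
  proof -
    have "norm (star b) ^ 3 = norm (2 *\<^sub>R ((star b \<odot> b) \<odot> star b) - (star b \<odot> star b) \<odot> b)"
      using norm_U_op_star[of "star b"] scaleR_scaleC[of 2 "(star b \<odot> b) \<odot> star b"]
      by (simp add: U_op_def star_star)
    also have "\<dots> \<le> norm (2 *\<^sub>R ((star b \<odot> b) \<odot> star b)) + norm ((star b \<odot> star b) \<odot> b)"
      by (rule norm_triangle_ineq4)
    also have "\<dots> \<le> 2 * ((norm (star b) * norm b) * norm (star b))
        + (norm (star b) * norm (star b)) * norm b"
    proof (intro add_mono)
      have "norm ((star b \<odot> b) \<odot> star b) \<le> norm (star b \<odot> b) * norm (star b)"
        by (rule norm_jprod_le)
      also have "\<dots> \<le> (norm (star b) * norm b) * norm (star b)"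
        by (intro mult_right_mono norm_jprod_le norm_ge_zero)
      finally show "norm (2 *\<^sub>R ((star b \<odot> b) \<odot> star b))
        \<le> 2 * ((norm (star b) * norm b) * norm (star b))" by simp
      have "norm ((star b \<odot> star b) \<odot> b) \<le> norm (star b \<odot> star b) * norm b"
        by (rule norm_jprod_le)
      also have "\<dots> \<le> (norm (star b) * norm (star b)) * norm b"
        by (intro mult_right_mono norm_jprod_le norm_ge_zero)
      finally show "norm ((star b \<odot> star b) \<odot> b) \<le> (norm (star b) * norm (star b)) * norm b" .
    qed
    finally show ?thesis by (simp add: power2_eq_square algebra_simps)
  qed
  from this[of a] show ?thesis
    by (cases "norm (star a) = 0") (auto simp: power3_eq_cube power2_eq_square)
qed

lemma bounded_linear_star: "bounded_linear (star :: 'a::jb_star_algebra \<Rightarrow> 'a)"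
proof (rule bounded_linear_intro[where K = 3])
  fix r :: real and a b :: 'a
  show "star (a + b) = star a + star b" by (rule star_add)
  show "star (r *\<^sub>R a) = r *\<^sub>R star a" by (simp add: scaleR_scaleC star_scaleC)
  show "norm (star a) \<le> norm a * 3" using norm_star_le[of a] by (simp add: mult.commute)
qed

lemmas star_linear =
  linear_add[OF bounded_linear.linear[OF bounded_linear_star]]
  linear_diff[OF bounded_linear.linear[OF bounded_linear_star]]
  linear_neg[OF bounded_linear.linear[OF bounded_linear_star]]
  linear_scale[OF bounded_linear.linear[OF bounded_linear_star]]

definition jone :: "'a::unital_jb_star_algebra" where
  "jone = (SOME u. \<forall>a. u \<odot> a = a)"

lemma jone_left [simp]: "jone \<odot> a = (a::'a::unital_jb_star_algebra)"
  unfolding jone_def using someI_ex[OF ex_unit] by auto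

lemma jone_right [simp]: "a \<odot> jone = (a::'a::unital_jb_star_algebra)"
  by (metis jone_left jprod_commute)

lemma star_jone [simp]: "star (jone::'a::unital_jb_star_algebra) = jone"
  by (metis jone_left jone_right star_jprod star_star)

lemma le_one_of_cube_eq: "t = t ^ 3 \<Longrightarrow> t \<le> (1::real)"
  by (rule ccontr) (use power_strict_increasing[of 1 3 t] in auto)

lemma norm_projection_le:
  fixes e :: "'a::jb_star_algebra"
  assumes "is_projection e" shows "norm e \<le> 1"
proof (rule le_one_of_cube_eq)
  show "norm e = norm e ^ 3"
    using U_op_star_self_adjoint[of e] assms by (simp add: is_projection_def)
qed

lemma is_projection_jone: "is_projection (jone::'a::unital_jb_star_algebra)"
  by (simp add: is_projection_def)

lemma is_projection_complement:
  fixes e :: "'a::unital_jb_star_algebra"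
  assumes "is_projection e" shows "is_projection (jone - e)"
  using assms by (simp add: is_projection_def star_linear jprod_linear)

section \<open>Power associativity\<close>

primrec jpow :: "'a::unital_jb_star_algebra \<Rightarrow> nat \<Rightarrow> 'a" where
  "jpow a 0 = jone"
| "jpow a (Suc n) = a \<odot> jpow a n"

text \<open>
  A recursion that expresses multiplication by \<open>jpow a n\<close> as a polynomial in the two operators of
  multiplication by \<open>a\<close> and by \<open>a \<odot> a\<close>. These two commute by the Jordan identity, so all
  multiplications by powers of \<open>a\<close> commute, and power associativity follows.
\<close>

lemma jpow_Suc_Suc_jprod:
  "jpow a (Suc (Suc n)) \<odot> x = (a \<odot> a) \<odot> (jpow a n \<odot> x)
     + 2 *\<^sub>R (jpow a (Suc n) \<odot> (a \<odot> x)) - a \<odot> (a \<odot> (jpow a n \<odot> x)) - jpow a n \<odot> (a \<odot> (a \<odot> x))"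
  using jordan_identity_multilinear[of a a "jpow a n" x]
  by (simp add: jprod_commute algebra_simps scaleR_2)

lemma commuting_operator_jpow:
  fixes a :: "'a::unital_jb_star_algebra"
  assumes T: "linear T" and "\<And>x. T (a \<odot> x) = a \<odot> T x"
    and "\<And>x. T ((a \<odot> a) \<odot> x) = (a \<odot> a) \<odot> T x"
  shows "T (jpow a n \<odot> x) = jpow a n \<odot> T x"
proof (induction n arbitrary: x rule: induct_nat_012)
  case (ge2 n)
  then show ?case
    unfolding jpow_Suc_Suc_jprod
    by (simp only: linear_add[OF T] linear_diff[OF T] linear_scale[OF T] assms)
qed (simp_all add: assms)

lemma linear_jprod: "linear ((\<odot>) (a::'a::jb_star_algebra))"
  by (rule linearI) (simp_all add: jprod_linear)

lemma jpow_operator_commute: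
  fixes a :: "'a::unital_jb_star_algebra"
  shows "jpow a m \<odot> (jpow a n \<odot> x) = jpow a n \<odot> (jpow a m \<odot> x)"
proof -
  have sq: "(a \<odot> a) \<odot> (a \<odot> x) = a \<odot> ((a \<odot> a) \<odot> x)" for x
    using jordan_identity[of x a] by (simp add: jprod_commute)
  have 1: "a \<odot> (jpow a n \<odot> x) = jpow a n \<odot> (a \<odot> x)" for n x
    by (rule commuting_operator_jpow[OF linear_jprod]) (simp_all add: sq)
  have 2: "(a \<odot> a) \<odot> (jpow a n \<odot> x) = jpow a n \<odot> ((a \<odot> a) \<odot> x)" for n x
    by (rule commuting_operator_jpow[OF linear_jprod]) (simp_all add: sq)
  show ?thesis
    by (rule commuting_operator_jpow[OF linear_jprod]) (simp_all add: 1 2)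
qed

lemma jpow_add: "jpow a m \<odot> jpow a n = jpow a (m + n)"
proof (induction n)
  case (Suc n)
  have "jpow a m \<odot> (a \<odot> jpow a n) = a \<odot> (jpow a m \<odot> jpow a n)"
    using jpow_operator_commute[of a m 1 "jpow a n"] by simp
  with Suc show ?case by simp
qed simp

lemma span_jpow_operator_commute:
  assumes b: "b \<in> span (range (jpow a))" and c: "c \<in> span (range (jpow a))"
  shows "b \<odot> (c \<odot> x) = c \<odot> (b \<odot> x)"
  using b
proof (induction rule: span_induct_alt)
  case base
  then show ?case by (simp add: jprod_linear)
next
  case (step r b' y)
  then obtain n where n: "b' = jpow a n" by auto
  have "jpow a n \<odot> (c \<odot> x) = c \<odot> (jpow a n \<odot> x)"
    using c
  proof (induction rule: span_induct_alt)
    case (step s c' z)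
    then obtain m where "c' = jpow a m" by auto
    with step show ?case by (simp add: jprod_linear jpow_operator_commute[of a n m])
  qed (simp add: jprod_linear)
  with step n show ?case by (simp add: jprod_linear)
qed

lemma span_jpow_jprod:
  assumes b: "b \<in> span (range (jpow a))" and c: "c \<in> span (range (jpow a))"
  shows "b \<odot> c \<in> span (range (jpow a))"
  using b
proof (induction rule: span_induct_alt)
  case base
  then show ?case by (simp add: span_zero jprod_linear)
next
  case (step r b' y)
  then obtain n where n: "b' = jpow a n" by auto
  have "jpow a n \<odot> c \<in> span (range (jpow a))"
    using c
  proof (induction rule: span_induct_alt)
    case (step s c' z)
    then obtain m where "c' = jpow a m" by auto
    with step show ?case
      by (simp add: jprod_linear jpow_add span_add span_scale span_base)
  qed (simp add: span_zero jprod_linear)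
  with step n show ?case by (simp add: jprod_linear span_add span_scale)
qed

lemma closure_of_subspace:
  fixes S :: "'a::real_normed_vector set"
  assumes S: "subspace S" shows "subspace (closure S)"
proof (rule subspaceI)
  show "0 \<in> closure S" using subspace_0[OF S] closure_subset by blast
next
  fix x y assume "x \<in> closure S" "y \<in> closure S"
  then obtain f g where "\<And>n. f n \<in> S" "f \<longlonglongrightarrow> x" "\<And>n. g n \<in> S" "g \<longlonglongrightarrow> y"
    by (auto simp: closure_sequential)
  then show "x + y \<in> closure S"
    unfolding closure_sequential
    by (intro exI[of _ "\<lambda>n. f n + g n"]) (simp add: subspace_add[OF S] tendsto_add)
next
  fix c x assume "x \<in> closure S"
  then obtain f where "\<And>n. f n \<in> S" "f \<longlonglongrightarrow> x" by (auto simp: closure_sequential)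
  then show "c *\<^sub>R x \<in> closure S"
    unfolding closure_sequential
    by (intro exI[of _ "\<lambda>n. c *\<^sub>R f n"]) (simp add: subspace_scale[OF S] tendsto_scaleR)
qed

text \<open>
  On the closed subalgebra generated by one element all multiplication operators commute; together
  with commutativity of the product this makes that subalgebra associative.
\<close>

lemma closure_span_jpow_operator_commute:
  assumes b: "b \<in> closure (span (range (jpow a)))" and c: "c \<in> closure (span (range (jpow a)))"
  shows "b \<odot> (c \<odot> x) = c \<odot> (b \<odot> x)"
proof -
  obtain f where f: "\<And>n. f n \<in> span (range (jpow a))" "f \<longlonglongrightarrow> b"
    using b by (auto simp: closure_sequential)
  obtain g where g: "\<And>n. g n \<in> span (range (jpow a))" "g \<longlonglongrightarrow> c"
    using c by (auto simp: closure_sequential)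
  have "(\<lambda>n. f n \<odot> (g n \<odot> x)) \<longlonglongrightarrow> b \<odot> (c \<odot> x)"
    by (intro jprod.tendsto f g tendsto_const)
  moreover have "(\<lambda>n. f n \<odot> (g n \<odot> x)) \<longlonglongrightarrow> c \<odot> (b \<odot> x)"
    unfolding span_jpow_operator_commute[OF f(1) g(1)]
    by (intro jprod.tendsto f g tendsto_const)
  ultimately show ?thesis by (rule LIMSEQ_unique)
qed

lemma closure_span_jpow_jprod:
  assumes b: "b \<in> closure (span (range (jpow a)))" and c: "c \<in> closure (span (range (jpow a)))"
  shows "b \<odot> c \<in> closure (span (range (jpow a)))"
proof -
  obtain f where f: "\<And>n. f n \<in> span (range (jpow a))" "f \<longlonglongrightarrow> b"
    using b by (auto simp: closure_sequential)
  obtain g where g: "\<And>n. g n \<in> span (range (jpow a))" "g \<longlonglongrightarrow> c"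
    using c by (auto simp: closure_sequential)
  have "(\<lambda>n. f n \<odot> g n) \<longlonglongrightarrow> b \<odot> c"
    by (intro jprod.tendsto f g)
  then show ?thesis
    unfolding closure_sequential
    by (intro exI[of _ "\<lambda>n. f n \<odot> g n"]) (simp add: span_jpow_jprod f g)
qed

section \<open>Square roots\<close>

text \<open>
  With \<open>y\<close> as here, \<open>1 - y\<close> is a square root of \<open>1 - c\<close>. The iteration \<open>y \<mapsto> (c + y\<^sup>2)/2\<close> from \<open>0\<close>
  is dominated termwise by the same iteration for the real number \<open>1\<close>, which increases and is
  bounded by \<open>1\<close>. The domination uses \<open>u\<^sup>2 - v\<^sup>2 = (u - v) \<odot> (u + v)\<close>, which holds in any
  commutative algebra, so no associativity enters. The set \<open>S\<close> records where the root can be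
  found.
\<close>

lemma sqrt_fixed_point:
  fixes c :: "'a::jb_star_algebra"
  assumes c: "norm c \<le> 1" and S: "closed S" "0 \<in> S"
    and step: "\<And>y. y \<in> S \<Longrightarrow> (1/2) *\<^sub>R (c + y \<odot> y) \<in> S"
  obtains y where "y \<in> S" "y \<odot> y = 2 *\<^sub>R y - c"
proof -
  define y where "y = rec_nat (0::'a) (\<lambda>_ y. (1/2) *\<^sub>R (c + y \<odot> y))"
  define s where "s = rec_nat (0::real) (\<lambda>_ s. (1/2) * (1 + s * s))"
  have y0: "y 0 = 0" and yS: "y (Suc n) = (1/2) *\<^sub>R (c + y n \<odot> y n)" for n
    by (simp_all add: y_def)
  have s0: "s 0 = 0" and sS: "s (Suc n) = (1/2) * (1 + s n * s n)" for n
    by (simp_all add: s_def)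
  have yin: "y n \<in> S" for n by (induction n) (simp_all add: y0 yS S step del: scaleR_add_right)
  have s01: "0 \<le> s n \<and> s n \<le> 1" for n
  proof (induction n)
    case (Suc n)
    then have "s n * s n \<le> 1 * 1" by (intro mult_mono) auto
    then show ?case by (simp add: sS)
  qed (simp add: s0)
  have ys: "norm (y n) \<le> s n" for n
  proof (induction n)
    case (Suc n)
    have "norm (c + y n \<odot> y n) \<le> norm c + norm (y n) * norm (y n)"
      by (rule order_trans[OF norm_triangle_ineq]) (simp add: norm_jprod_le)
    also have "\<dots> \<le> 1 + s n * s n"
      using Suc c s01[of n] by (intro add_mono mult_mono) auto
    finally show ?case by (simp add: yS sS del: scaleR_add_right)
  qed (simp add: y0 s0)
  have d: "norm (y (Suc n) - y n) \<le> s (Suc n) - s n" for n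
  proof (induction n)
    case 0
    then show ?case using c by (simp add: yS sS y0 s0 jprod.zero_left)
  next
    case (Suc n)
    define u v where "u = y (Suc n)" and "v = y n"
    have "y (Suc (Suc n)) - y (Suc n) = (1/2) *\<^sub>R ((c + u \<odot> u) - (c + v \<odot> v))"
      unfolding scaleR_diff_right yS[of "Suc n"] yS[of n] u_def v_def by (rule refl)
    also have "(c + u \<odot> u) - (c + v \<odot> v) = (u - v) \<odot> (u + v)"
      by (simp add: jprod_linear jprod_commute[of v u])
    finally have "norm (y (Suc (Suc n)) - y (Suc n)) \<le> (1/2) * (norm (u - v) * norm (u + v))"
      by (simp add: norm_jprod_le)
    also have "\<dots> \<le> (1/2) * ((s (Suc n) - s n) * (s (Suc n) + s n))"
    proof (intro mult_left_mono mult_mono)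
      show "norm (u - v) \<le> s (Suc n) - s n" using Suc by (simp add: u_def v_def)
      then show "0 \<le> s (Suc n) - s n" by (rule order_trans[OF norm_ge_zero])
      show "norm (u + v) \<le> s (Suc n) + s n"
        unfolding u_def v_def by (rule norm_triangle_mono[OF ys ys])
    qed auto
    also have "\<dots> = s (Suc (Suc n)) - s (Suc n)"
      unfolding sS[of "Suc n"] using sS[of n] by (simp add: algebra_simps)
    finally show ?case .
  qed
  have "incseq s"
    by (rule incseq_SucI) (metis d norm_ge_zero order_trans diff_ge_0_iff_ge)
  then obtain l where "s \<longlonglongrightarrow> l" by (rule incseq_convergent[of s 1]) (use s01 in auto)
  then have "summable (\<lambda>n. s (Suc n) - s n)" by (rule telescope_summable)
  then have "summable (\<lambda>n. y (Suc n) - y n)"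
    by (rule summable_comparison_test'[where N = 0]) (use d in auto)
  then have "convergent (\<lambda>n. \<Sum>i<n. y (Suc i) - y i)" by (simp add: summable_iff_convergent)
  then obtain z where z: "y \<longlonglongrightarrow> z" by (auto simp: sum_lessThan_telescope y0 convergent_def)
  have "(\<lambda>n. y (Suc n)) \<longlonglongrightarrow> (1/2) *\<^sub>R (c + z \<odot> z)"
    unfolding yS by (intro tendsto_intros jprod.tendsto z)
  then have "z = (1/2) *\<^sub>R (c + z \<odot> z)"
    using LIMSEQ_Suc[OF z] by (rule LIMSEQ_unique[rotated])
  then have "2 *\<^sub>R z = c + z \<odot> z" by (metis scaleR_half_double scaleR_2 scaleR_add_right)
  moreover have "z \<in> S" using closed_sequentially[OF S(1) yin z] .
  ultimately show ?thesis using that by (simp add: algebra_simps)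
qed


section \<open>Peirce calculus\<close>

text \<open>
  Multiplication by an element of a Peirce space for the eigenvalue \<open>0\<close> or \<open>1\<close> preserves every
  Peirce space of the idempotent \<open>e\<close>: the linearised Jordan identity at \<open>a, e, c\<close> reads
  \<open>(1 - 2j)(e \<odot> w - i w) = 0\<close> with \<open>w = a \<odot> c\<close>.
\<close>

lemma peirce_jprod:
  fixes e a c :: "'a::jb_star_algebra"
  assumes "e \<odot> e = e" "e \<odot> a = i *\<^sub>R a" "e \<odot> c = j *\<^sub>R c" and j: "j \<noteq> 1/2"
  shows "e \<odot> (a \<odot> c) = i *\<^sub>R (a \<odot> c)"
proof -
  have "(2 * i * j) *\<^sub>R (a \<odot> c) + e \<odot> (a \<odot> c) = (2 * j) *\<^sub>R (e \<odot> (a \<odot> c)) + i *\<^sub>R (a \<odot> c)"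
    using jordan_identity_linear[of a e c] assms jprod_commute[of a e] jprod_commute[of "a \<odot> c" e]
    by (simp add: jprod_linear mult_ac)
  then have "(1 - 2 * j) *\<^sub>R (e \<odot> (a \<odot> c) - i *\<^sub>R (a \<odot> c)) = 0"
    by (simp add: algebra_simps)
  with j show ?thesis by simp
qed

text \<open>
  Squares of half-space elements have components for the eigenvalues \<open>0\<close> and \<open>1\<close> only.
\<close>

lemma peirce_half_square:
  fixes e z :: "'a::jb_star_algebra"
  assumes "e \<odot> e = e" "e \<odot> z = (1/2) *\<^sub>R z"
  shows "e \<odot> (e \<odot> (z \<odot> z)) = e \<odot> (z \<odot> z)"
  using jordan_identity_linear[of e z e] assms
    jprod_commute[of z e] jprod_commute[of "z \<odot> z" e] jprod_commute[of "e \<odot> (z \<odot> z)" e]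
  by (simp add: jprod_linear)

text \<open>
  Multiplication \<open>L\<close> by an idempotent satisfies \<open>2L\<^sup>3 - 3L\<^sup>2 + L = 0\<close>, so its eigenvalues are \<open>0\<close>,
  \<open>1/2\<close> and \<open>1\<close>.
\<close>

lemma peirce_polynomial:
  fixes e a :: "'a::jb_star_algebra"
  assumes "e \<odot> e = e"
  shows "2 *\<^sub>R (e \<odot> (e \<odot> (e \<odot> a))) = 3 *\<^sub>R (e \<odot> (e \<odot> a)) - e \<odot> a"
proof -
  have "2 *\<^sub>R (e \<odot> (e \<odot> a)) + e \<odot> (e \<odot> a) = 2 *\<^sub>R (e \<odot> (e \<odot> (e \<odot> a))) + e \<odot> a"
    using jordan_identity_linear[of e e a] assms
      jprod_commute[of "e \<odot> a" e] jprod_commute[of "e \<odot> (e \<odot> a)" e] by simp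
  moreover have "3 *\<^sub>R (e \<odot> (e \<odot> a)) = 2 *\<^sub>R (e \<odot> (e \<odot> a)) + e \<odot> (e \<odot> a)"
    using scaleR_add_left[of 2 1 "e \<odot> (e \<odot> a)"] by simp
  ultimately show ?thesis by (simp add: algebra_simps)
qed

text \<open>
  The Peirce projections onto the eigenspaces \<open>1\<close> and \<open>1/2\<close> of multiplication by \<open>e\<close>, as Lagrange
  polynomials in that operator. The one onto the eigenspace \<open>0\<close> is \<open>corner (jone - e)\<close>.
\<close>

definition corner :: "'a::jb_star_algebra \<Rightarrow> 'a \<Rightarrow> 'a" where
  "corner e a = 2 *\<^sub>R (e \<odot> (e \<odot> a)) - e \<odot> a"

definition off_corner :: "'a::jb_star_algebra \<Rightarrow> 'a \<Rightarrow> 'a" where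
  "off_corner e a = 4 *\<^sub>R (e \<odot> a - e \<odot> (e \<odot> a))"

lemma corner_linear:
  "corner e (a + b) = corner e a + corner e b"
  "corner e (a - b) = corner e a - corner e b"
  "corner e (r *\<^sub>R a) = r *\<^sub>R corner e a"
  by (simp_all add: corner_def jprod_linear algebra_simps)

lemma jprod_corner:
  assumes "is_projection e" shows "e \<odot> corner e a = corner e a"
  using peirce_polynomial[of e a] assms scaleR_add_left[of 2 1 "e \<odot> (e \<odot> a)"]
  by (simp add: is_projection_def corner_def jprod_linear)

lemma jprod_off_corner:
  assumes "is_projection e" shows "e \<odot> off_corner e a = (1/2) *\<^sub>R off_corner e a"
proof -
  define v w where "v = e \<odot> a" and "w = e \<odot> v"
  have "2 *\<^sub>R (e \<odot> w) = 3 *\<^sub>R w - v"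
    using peirce_polynomial[of e a] assms by (simp add: is_projection_def v_def w_def)
  also have "3 *\<^sub>R w = 2 *\<^sub>R w + w" using scaleR_add_left[of 2 1 w] by simp
  finally have "e \<odot> w = w + (1/2) *\<^sub>R (w - v)"
    using scaleR_cancel_left[of 2 "e \<odot> w" "w + (1/2) *\<^sub>R (w - v)"]
    by (simp add: scaleR_add_right del: scaleR_cancel_left)
  moreover have "off_corner e a = 4 *\<^sub>R (v - w)" by (simp add: off_corner_def v_def w_def)
  moreover have "e \<odot> (v - w) = w - e \<odot> w" by (simp add: jprod_linear w_def)
  ultimately show ?thesis
    by (simp add: jprod.scaleR_right flip: scaleR_minus_right)
qed

lemma star_corner:
  assumes "is_projection e" "star a = a"
  shows "star (corner e a) = corner e a" "star (off_corner e a) = off_corner e a"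
  using assms by (simp_all add: corner_def off_corner_def is_projection_def star_linear star_jprod)

lemma peirce_decomposition:
  fixes e a :: "'a::unital_jb_star_algebra"
  shows "corner e a + off_corner e a + corner (jone - e) a = a"
proof -
  have "4 *\<^sub>R v = v + v + v + v" for v :: 'a
    using scaleR_add_left[of 2 2 v] by (simp add: scaleR_2)
  then show ?thesis
    by (simp add: corner_def off_corner_def jprod_linear scaleR_2 algebra_simps)
qed

lemma off_corner_complement:
  fixes e a :: "'a::unital_jb_star_algebra"
  shows "off_corner (jone - e) a = off_corner e a"
  by (simp add: off_corner_def jprod_linear algebra_simps)

text \<open>
  Write \<open>h = a + z + b\<close> with \<open>a\<close>, \<open>z\<close>, \<open>b\<close> in the Peirce spaces for \<open>1\<close>, \<open>1/2\<close>, \<open>0\<close>. In \<open>h \<odot> h\<close>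
  the mixed products with \<open>z\<close> lie in the half space and \<open>a \<odot> b = 0\<close>.
\<close>

lemma corner_square:
  fixes e h :: "'a::unital_jb_star_algebra"
  assumes e: "is_projection e"
  shows "corner e (h \<odot> h) = corner e h \<odot> corner e h + e \<odot> (off_corner e h \<odot> off_corner e h)"
proof -
  define a where "a = corner e h"
  define z where "z = off_corner e h"
  define b where "b = corner (jone - e) h"
  have ee: "e \<odot> e = e" using e by (simp add: is_projection_def)
  have a: "e \<odot> a = 1 *\<^sub>R a" using e by (simp add: a_def jprod_corner)
  have z: "e \<odot> z = (1/2) *\<^sub>R z" using e by (simp add: z_def jprod_off_corner)
  have b: "e \<odot> b = 0 *\<^sub>R b"
    using jprod_corner[OF is_projection_complement[OF e], of h] by (simp add: b_def jprod_linear)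
  have h: "h = a + z + b" unfolding a_def b_def z_def by (simp add: peirce_decomposition)
  have ab: "a \<odot> b = 0"
    using peirce_jprod[OF ee a b] peirce_jprod[OF ee b a] jprod_commute[of a b] by simp
  have "h \<odot> h = a \<odot> a + z \<odot> z + b \<odot> b + 2 *\<^sub>R (z \<odot> a) + 2 *\<^sub>R (z \<odot> b)"
    unfolding h using ab jprod_commute[of b a] jprod_commute[of a z] jprod_commute[of b z]
    by (simp add: jprod_linear scaleR_2 algebra_simps)
  moreover have "corner e (a \<odot> a) = a \<odot> a"
    using peirce_jprod[OF ee a a] by (simp add: corner_def scaleR_2)
  moreover have "corner e (b \<odot> b) = 0"
    using peirce_jprod[OF ee b b] by (simp add: corner_def jprod_linear)
  moreover have "corner e (z \<odot> a) = 0"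
    using peirce_jprod[OF ee z a] by (simp add: corner_def jprod_linear)
  moreover have "corner e (z \<odot> b) = 0"
    using peirce_jprod[OF ee z b] by (simp add: corner_def jprod_linear)
  moreover have "corner e (z \<odot> z) = e \<odot> (z \<odot> z)"
    using peirce_half_square[OF ee z] by (simp add: corner_def scaleR_2)
  ultimately have "corner e (h \<odot> h) = a \<odot> a + e \<odot> (z \<odot> z)" by (simp add: corner_linear)
  then show ?thesis by (simp add: a_def z_def)
qed

section \<open>Norm and order\<close>

lemma square_in_positive_cone: "star h = h \<Longrightarrow> h \<odot> h \<in> positive_cone"
  by (auto simp: positive_cone_def)

lemma star_positive_cone: "a \<in> positive_cone \<Longrightarrow> star a = a"
  by (auto simp: positive_cone_def star_jprod)

lemma positive_cone_scaleR:
  fixes a :: "'a::jb_star_algebra"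
  assumes "a \<in> positive_cone" "0 \<le> r" shows "r *\<^sub>R a \<in> positive_cone"
proof -
  obtain h where h: "a = h \<odot> h" "star h = h" using assms by (auto simp: positive_cone_def)
  have "r *\<^sub>R a = (sqrt r *\<^sub>R h) \<odot> (sqrt r *\<^sub>R h)"
    using assms by (simp add: h jprod_linear)
  moreover have "(sqrt r *\<^sub>R h) \<odot> (sqrt r *\<^sub>R h) \<in> positive_cone"
    by (rule square_in_positive_cone) (simp add: star_linear h)
  ultimately show ?thesis by simp
qed

lemma zero_in_positive_cone: "(0::'a::jb_star_algebra) \<in> positive_cone"
  using square_in_positive_cone[of "0::'a"] by (simp add: jprod_linear)

lemma projection_in_positive_cone: "is_projection e \<Longrightarrow> e \<in> positive_cone"
  using square_in_positive_cone[of e] by (simp add: is_projection_def)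

text \<open>
  The criterion for membership in the cone: \<open>b / t = e - c\<close> with \<open>norm c \<le> 1\<close>, and the square root
  of \<open>e - c\<close> is found inside the algebra \<open>{y. e \<odot> y = y}\<close>, whose unit is \<open>e\<close>. The freedom in \<open>e\<close>
  gives inequalities below a projection from norm estimates.
\<close>

lemma positive_cone_corner:
  fixes b :: "'a::jb_star_algebra"
  assumes e: "is_projection e" and b: "star b = b" "e \<odot> b = b"
    and t: "norm (t *\<^sub>R e - b) \<le> t"
  shows "b \<in> positive_cone"
proof (cases "t = 0")
  case True
  then show ?thesis using t zero_in_positive_cone by simp
next
  case False
  then have t0: "t > 0" using t norm_ge_zero[of "t *\<^sub>R e - b"] by linarith
  have ee: "e \<odot> e = e" "star e = e" using e by (simp_all add: is_projection_def)
  define c where "c = e - (1/t) *\<^sub>R b"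
  have "c = (1/t) *\<^sub>R (t *\<^sub>R e - b)" using t0 by (simp add: c_def algebra_simps)
  then have c1: "norm c \<le> 1" using t t0 by (simp add: divide_simps)
  have ec: "e \<odot> c = c" "star c = c" using b ee by (simp_all add: c_def jprod_linear star_linear)
  define S where "S = {y. star y = y \<and> e \<odot> y = y}"
  have S: "closed S"
    unfolding S_def
    by (intro closed_Collect_conj closed_Collect_eq jprod.continuous_on continuous_on_const
        continuous_on_id linear_continuous_on bounded_linear_star)
  obtain y where y: "y \<in> S" "y \<odot> y = 2 *\<^sub>R y - c"
  proof (rule sqrt_fixed_point[OF c1 S])
    fix y assume "y \<in> S"
    then have y: "star y = y" "e \<odot> y = 1 *\<^sub>R y" by (auto simp: S_def)
    have "e \<odot> (y \<odot> y) = y \<odot> y" using peirce_jprod[OF ee(1) y(2) y(2)] by simp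
    then show "(1/2) *\<^sub>R (c + y \<odot> y) \<in> S"
      by (simp add: S_def star_linear star_jprod y jprod_linear ec)
  qed (auto simp: S_def jprod_linear)
  have "(e - y) \<odot> (e - y) = (1/t) *\<^sub>R b"
    using y jprod_commute[of y e] by (simp add: S_def jprod_linear ee scaleR_2 c_def)
  then have "b = t *\<^sub>R ((e - y) \<odot> (e - y))" using t0 by simp
  moreover have "star (e - y) = e - y" using y by (simp add: S_def star_linear ee)
  ultimately show ?thesis
    using t0 by (metis positive_cone_scaleR square_in_positive_cone less_imp_le)
qed

text \<open>
  Rules that turn \<open>\<i>\<close> into a formal symbol with square \<open>-1\<close>, for computing with \<open>h + \<i> *\<^sub>C k\<close>.
\<close>

lemma scaleC_ii:
  fixes a b :: "'a::jb_star_algebra"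
  shows "\<i> *\<^sub>C (a + b) = \<i> *\<^sub>C a + \<i> *\<^sub>C b" "\<i> *\<^sub>C (- a) = - (\<i> *\<^sub>C a)"
    "\<i> *\<^sub>C (a - b) = \<i> *\<^sub>C a - \<i> *\<^sub>C b"
    "\<i> *\<^sub>C (\<i> *\<^sub>C a) = - a" "(\<i> *\<^sub>C a) \<odot> b = \<i> *\<^sub>C (a \<odot> b)" "a \<odot> (\<i> *\<^sub>C b) = \<i> *\<^sub>C (a \<odot> b)"
    "star (\<i> *\<^sub>C a) = - (\<i> *\<^sub>C star a)"
proof -
  show add: "\<i> *\<^sub>C (a + b) = \<i> *\<^sub>C a + \<i> *\<^sub>C b" for a b :: 'a by (rule scaleC_add_right)
  from add[of 0 0] have "\<i> *\<^sub>C 0 = (0::'a)" by simp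
  with add[of a "- a"] show m: "\<i> *\<^sub>C (- a) = - (\<i> *\<^sub>C a)" for a :: 'a
    by (metis add add.right_inverse add_eq_0_iff)
  show "\<i> *\<^sub>C (a - b) = \<i> *\<^sub>C a - \<i> *\<^sub>C b"
    using add[of a "- b"] m[of b] by simp
  have "\<i> *\<^sub>C (\<i> *\<^sub>C a) = complex_of_real (- 1) *\<^sub>C a" by (simp add: scaleC_scaleC)
  then show "\<i> *\<^sub>C (\<i> *\<^sub>C a) = - a" using scaleR_scaleC[of "- 1" a] by simp
  show l: "(\<i> *\<^sub>C a) \<odot> b = \<i> *\<^sub>C (a \<odot> b)" for a b :: 'a by (rule jprod_scaleC_left)
  show "a \<odot> (\<i> *\<^sub>C b) = \<i> *\<^sub>C (a \<odot> b)" by (metis l jprod_commute)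
  have "star (\<i> *\<^sub>C a) + \<i> *\<^sub>C star a = (- \<i> + \<i>) *\<^sub>C star a"
    by (simp only: star_scaleC scaleC_add_left complex_cnj_i)
  also have "\<dots> = 0" using scaleR_scaleC[of 0 "star a"] by simp
  finally show "star (\<i> *\<^sub>C a) = - (\<i> *\<^sub>C star a)" by (simp add: eq_neg_iff_add_eq_0)
qed

text \<open>
  The element \<open>u = h + \<i> *\<^sub>C k\<close> satisfies \<open>u \<odot> star u = jone\<close>, and under the stated instances of
  associativity \<open>U_op u (star u) = u\<close>. The norm axiom becomes \<open>norm u = norm u ^ 3\<close>.
\<close>

lemma norm_unitary_le:
  fixes h k :: "'a::unital_jb_star_algebra"
  assumes "star h = h" "star k = k" and hk: "h \<odot> h + k \<odot> k = jone"
    and "(h \<odot> k) \<odot> k = h \<odot> (k \<odot> k)" "(h \<odot> k) \<odot> h = k \<odot> (h \<odot> h)"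
  shows "norm (h + \<i> *\<^sub>C k) \<le> 1"
proof -
  define u where "u = h + \<i> *\<^sub>C k"
  have us: "star u = h - \<i> *\<^sub>C k" by (simp add: u_def star_linear scaleC_ii assms)
  have 1: "u \<odot> star u = jone"
    unfolding us unfolding u_def using hk jprod_commute[of k h] by (simp add: scaleC_ii jprod_linear)
  have uu: "u \<odot> u = h \<odot> h - k \<odot> k + \<i> *\<^sub>C (2 *\<^sub>R (h \<odot> k))"
    unfolding u_def using jprod_commute[of k h] by (simp add: scaleC_ii jprod_linear scaleR_2)
  have kk: "k \<odot> k = jone - h \<odot> h" using hk by (simp add: algebra_simps)
  have 2: "(u \<odot> u) \<odot> star u = u"
    unfolding us uu unfolding u_def
    using assms(4,5) jprod_commute[of "h \<odot> h" k] jprod_commute[of "h \<odot> h" h]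
    by (simp add: scaleC_ii jprod_linear scaleR_2 kk)
  have "U_op u (star u) = u"
    unfolding U_op_def 1 2 using scaleR_scaleC[of 2 u, symmetric] by (simp add: scaleR_2)
  then have "norm u = norm u ^ 3" using norm_U_op_star[of u] by simp
  then show ?thesis unfolding u_def by (rule le_one_of_cube_eq)
qed

text \<open>
  This says that squares are positive in the sense of the norm. With \<open>k\<close> a square root of
  \<open>1 - h\<^sup>2\<close> in the closed subalgebra generated by \<open>h\<close>, the elements \<open>h \<plusminus> \<i> k\<close> have norm at most
  one, and \<open>2h\<^sup>2 - 1\<close> is the mean of their squares.
\<close>

lemma norm_one_minus_double_square_le:
  fixes h :: "'a::unital_jb_star_algebra"
  assumes h: "star h = h" and n: "norm (h \<odot> h) \<le> 1"
  shows "norm (jone - 2 *\<^sub>R (h \<odot> h)) \<le> 1"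
proof -
  define K where "K = closure (span (range (jpow h)))"
  have one: "jone \<in> K"
    unfolding K_def by (metis closure_subset jpow.simps(1) rangeI span_base subsetD)
  have "jpow h 1 \<in> K"
    unfolding K_def by (metis closure_subset rangeI span_base subsetD)
  then have hK: "h \<in> K" by simp
  have sub: "subspace K" unfolding K_def by (intro closure_of_subspace subspace_span)
  have mult: "a \<odot> b \<in> K" if "a \<in> K" "b \<in> K" for a b
    using that closure_span_jpow_jprod unfolding K_def by blast
  have comm: "a \<odot> (b \<odot> x) = b \<odot> (a \<odot> x)" if "a \<in> K" "b \<in> K" for a b x
    using that closure_span_jpow_operator_commute unfolding K_def by blast
  have S: "closed (K \<inter> {y. star y = y})"
    unfolding K_def
    by (intro closed_Int closed_closure closed_Collect_eq
        continuous_on_id linear_continuous_on bounded_linear_star)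
  obtain y where y: "y \<in> K" "star y = y" "y \<odot> y = 2 *\<^sub>R y - h \<odot> h"
  proof (rule sqrt_fixed_point[OF n S])
    fix y assume "y \<in> K \<inter> {y. star y = y}"
    then show "(1/2) *\<^sub>R (h \<odot> h + y \<odot> y) \<in> K \<inter> {y. star y = y}"
      using sub by (auto simp: star_linear star_jprod h intro!: subspace_scale subspace_add mult hK
          simp del: scaleR_add_right)
  qed (use sub in \<open>auto simp: subspace_0\<close>)
  define k where "k = jone - y"
  have k: "k \<in> K" "star k = k" using y one sub by (auto simp: k_def star_linear subspace_diff)
  have kk: "h \<odot> h + k \<odot> k = jone" by (simp add: k_def jprod_linear y scaleR_2)
  have A: "(h \<odot> k) \<odot> k = h \<odot> (k \<odot> k)" "(h \<odot> k) \<odot> h = k \<odot> (h \<odot> h)"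
    using comm[OF k(1) hK] jprod_commute by metis+
  have u: "norm (h + \<i> *\<^sub>C k) \<le> 1" using norm_unitary_le[OF h k(2) kk A] .
  have "norm (h + \<i> *\<^sub>C (- k)) \<le> 1"
    by (rule norm_unitary_le) (use h k kk A in \<open>simp_all add: star_linear jprod_linear\<close>)
  then have v: "norm (h - \<i> *\<^sub>C k) \<le> 1" by (simp add: scaleC_ii)
  have sq: "norm (a \<odot> a) \<le> 1" if "norm a \<le> 1" for a :: 'a
    using norm_jprod_le[of a a] mult_mono[of "norm a" 1 "norm a" 1] that by auto
  define X where "X = (h + \<i> *\<^sub>C k) \<odot> (h + \<i> *\<^sub>C k) + (h - \<i> *\<^sub>C k) \<odot> (h - \<i> *\<^sub>C k)"
  have "X = 2 *\<^sub>R (h \<odot> h - k \<odot> k)"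
    unfolding X_def by (simp add: scaleC_ii jprod_linear scaleR_2 algebra_simps)
  also have "k \<odot> k = jone - h \<odot> h" using kk by (simp add: algebra_simps)
  finally have "X = (- 2) *\<^sub>R (jone - 2 *\<^sub>R (h \<odot> h))" by (simp add: scaleR_2 algebra_simps)
  then have "norm (jone - 2 *\<^sub>R (h \<odot> h)) = norm X / 2" by simp
  also have "norm X \<le> 1 + 1" unfolding X_def by (rule norm_triangle_mono[OF sq[OF u] sq[OF v]])
  finally show ?thesis by simp
qed

lemma norm_jone_le: "norm (jone::'a::unital_jb_star_algebra) \<le> 1"
  by (rule norm_projection_le[OF is_projection_jone])

lemma norm_scaled_one_minus_le:
  fixes b :: "'a::unital_jb_star_algebra"
  assumes b: "b \<in> positive_cone" and t: "norm b \<le> 2 * t"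
  shows "norm (t *\<^sub>R jone - b) \<le> t"
proof (cases "t = 0")
  case True
  then show ?thesis using t by simp
next
  case False
  then have t0: "t > 0" using t norm_ge_zero[of b] by linarith
  obtain h where h: "(1 / (2 * t)) *\<^sub>R b = h \<odot> h" "star h = h"
    using positive_cone_scaleR[OF b, of "1 / (2 * t)"] t0 by (auto simp: positive_cone_def)
  have "norm (h \<odot> h) \<le> 1" using t0 t unfolding h(1)[symmetric] by simp
  then have "norm (jone - 2 *\<^sub>R (h \<odot> h)) \<le> 1" by (rule norm_one_minus_double_square_le[OF h(2)])
  moreover have "t *\<^sub>R jone - b = t *\<^sub>R (jone - 2 *\<^sub>R (h \<odot> h))"
    using t0 unfolding h(1)[symmetric] by (simp add: algebra_simps)
  ultimately show ?thesis using t0 by (simp add: mult_left_le)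
qed

lemma norm_bound_minus_positive:
  fixes b :: "'a::unital_jb_star_algebra"
  assumes "star b = b" "norm b \<le> t" shows "t *\<^sub>R jone - b \<in> positive_cone"
  by (rule positive_cone_corner[OF is_projection_jone, where t = t])
    (use assms in \<open>simp_all add: star_linear\<close>)

lemma positive_cone_add:
  fixes a b :: "'a::unital_jb_star_algebra"
  assumes "a \<in> positive_cone" "b \<in> positive_cone" shows "a + b \<in> positive_cone"
proof (rule positive_cone_corner[OF is_projection_jone, where t = "norm a + norm b"])
  show "star (a + b) = a + b" using assms by (simp add: star_linear star_positive_cone)
  have eq: "(norm a + norm b) *\<^sub>R jone - (a + b)
      = (norm a *\<^sub>R jone - a) + (norm b *\<^sub>R jone - b)"
    by (simp add: algebra_simps)
  show "norm ((norm a + norm b) *\<^sub>R jone - (a + b)) \<le> norm a + norm b"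
    unfolding eq by (intro norm_triangle_mono norm_scaled_one_minus_le assms) simp_all
qed simp

text \<open>
  For \<open>s > 0\<close>, put \<open>d = s - b\<close>. Both \<open>b\<close> and \<open>d\<close> are positive, hence within half of their norms of
  the corresponding multiple of the unit; the two resulting estimates for \<open>norm (s - b)\<close> and
  \<open>norm (s - d)\<close> are compatible only if \<open>norm b \<le> s\<close>. The case \<open>s = 0\<close> is obtained in the limit.
\<close>

lemma positive_norm_le:
  fixes b :: "'a::unital_jb_star_algebra"
  assumes b: "b \<in> positive_cone" and sb: "s *\<^sub>R jone - b \<in> positive_cone" and s: "0 \<le> s"
  shows "norm b \<le> s"
proof -
  have pos: "norm b \<le> s" if sb: "s *\<^sub>R jone - b \<in> positive_cone" and s: "0 < s" for s
  proof -
    define d where "d = s *\<^sub>R jone - b"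
    have aux: "norm (s *\<^sub>R jone - a) \<le> \<bar>s - norm a / 2\<bar> + norm a / 2"
      if "a \<in> positive_cone" for a :: 'a
    proof -
      have "s *\<^sub>R jone - a = (s - norm a / 2) *\<^sub>R jone + ((norm a / 2) *\<^sub>R jone - a)"
        by (simp add: algebra_simps)
      moreover have "norm ((s - norm a / 2) *\<^sub>R jone :: 'a) \<le> \<bar>s - norm a / 2\<bar>"
        using norm_jone_le[where 'a = 'a] by (simp add: mult_left_le)
      moreover have "norm ((norm a / 2) *\<^sub>R jone - a) \<le> norm a / 2"
        by (rule norm_scaled_one_minus_le[OF that]) simp
      ultimately show ?thesis using norm_triangle_mono by metis
    qed
    have "norm d \<le> \<bar>s - norm b / 2\<bar> + norm b / 2" unfolding d_def by (rule aux[OF b])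
    moreover have "norm b \<le> \<bar>s - norm d / 2\<bar> + norm d / 2"
      using aux[OF sb] by (simp add: d_def)
    ultimately show ?thesis using s by linarith
  qed
  show ?thesis
  proof (rule field_le_epsilon)
    fix \<epsilon> :: real assume "0 < \<epsilon>"
    moreover have "(s + \<epsilon>) *\<^sub>R jone - b \<in> positive_cone"
      using positive_cone_add[OF sb positive_cone_scaleR[of jone \<epsilon>]] \<open>0 < \<epsilon>\<close>
        projection_in_positive_cone[OF is_projection_jone]
      by (simp add: algebra_simps)
    ultimately show "norm b \<le> s + \<epsilon>" using s by (intro pos) auto
  qed
qed

lemma norm_le_interval:
  fixes a :: "'a::unital_jb_star_algebra"
  assumes "t *\<^sub>R jone + a \<in> positive_cone" "t *\<^sub>R jone - a \<in> positive_cone" "0 \<le> t"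
  shows "norm a \<le> t"
proof -
  have "norm (t *\<^sub>R jone + a) \<le> 2 * t"
    by (rule positive_norm_le) (use assms in \<open>simp_all add: scaleR_2 flip: scaleR_scaleR\<close>)
  then have "norm (t *\<^sub>R jone - (t *\<^sub>R jone + a)) \<le> t"
    by (rule norm_scaled_one_minus_le[OF assms(1)])
  then show ?thesis by simp
qed

lemma positive_norm_mono:
  fixes a b :: "'a::unital_jb_star_algebra"
  assumes a: "a \<in> positive_cone" and ba: "b - a \<in> positive_cone"
  shows "norm a \<le> norm b"
proof (rule positive_norm_le[OF a])
  have "star b = b"
    using star_positive_cone[OF positive_cone_add[OF a ba]] by simp
  then show "norm b *\<^sub>R jone - a \<in> positive_cone"
    using positive_cone_add[OF norm_bound_minus_positive[of b "norm b"] ba] by simp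
qed simp

text \<open>
  By \<open>corner_square\<close> it remains to see that \<open>e \<odot> (z \<odot> z)\<close> is positive for \<open>z\<close> in the half space.
  Multiplication by \<open>e\<close> is a contraction that maps \<open>t - z\<^sup>2\<close> to \<open>t e - e \<odot> z\<^sup>2\<close>, so the norm
  criterion passes from \<open>z\<^sup>2\<close> to its component.
\<close>

lemma corner_positive:
  fixes e a :: "'a::unital_jb_star_algebra"
  assumes e: "is_projection e" and a: "a \<in> positive_cone"
  shows "corner e a \<in> positive_cone"
proof -
  obtain h where h: "a = h \<odot> h" "star h = h" using a by (auto simp: positive_cone_def)
  define z where "z = off_corner e h"
  have ee: "e \<odot> e = e" "star e = e" using e by (simp_all add: is_projection_def)
  have z: "star z = z" "e \<odot> z = (1/2) *\<^sub>R z"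
    using e h by (simp_all add: z_def star_corner jprod_off_corner)
  define t where "t = norm (z \<odot> z)"
  have "e \<odot> (z \<odot> z) \<in> positive_cone"
  proof (rule positive_cone_corner[OF e, where t = t])
    show "star (e \<odot> (z \<odot> z)) = e \<odot> (z \<odot> z)" by (simp add: star_jprod ee z)
    show "e \<odot> (e \<odot> (z \<odot> z)) = e \<odot> (z \<odot> z)" by (rule peirce_half_square[OF ee(1) z(2)])
    have "t *\<^sub>R e - e \<odot> (z \<odot> z) = e \<odot> (t *\<^sub>R jone - z \<odot> z)" by (simp add: jprod_linear)
    also have "norm \<dots> \<le> norm e * norm (t *\<^sub>R jone - z \<odot> z)" by (rule norm_jprod_le)
    also have "\<dots> \<le> 1 * t"
    proof (intro mult_mono norm_projection_le e)
      show "norm (t *\<^sub>R jone - z \<odot> z) \<le> t"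
        by (rule norm_scaled_one_minus_le[OF square_in_positive_cone[OF z(1)]]) (simp add: t_def)
    qed auto
    finally show "norm (t *\<^sub>R e - e \<odot> (z \<odot> z)) \<le> t" by simp
  qed
  then show ?thesis
    unfolding h(1) corner_square[OF e] z_def[symmetric]
    by (intro positive_cone_add square_in_positive_cone) (simp_all add: star_corner e h)
qed

text \<open>
  Since \<open>w = 1 - 2q\<close> has norm at most one, \<open>1 - w\<^sup>2 = 4(q - q\<^sup>2)\<close> is positive.
\<close>

lemma square_le_self:
  fixes q :: "'a::unital_jb_star_algebra"
  assumes q: "q \<in> positive_cone" "norm q \<le> 1"
  shows "q - q \<odot> q \<in> positive_cone"
proof -
  obtain h where h: "q = h \<odot> h" "star h = h" using q by (auto simp: positive_cone_def)
  define w where "w = jone - 2 *\<^sub>R q"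
  have "norm w \<le> 1"
    unfolding w_def h(1) by (rule norm_one_minus_double_square_le) (use h q in auto)
  then have "norm (w \<odot> w) \<le> 1"
    using norm_jprod_le[of w w] mult_mono[of "norm w" 1 "norm w" 1] by auto
  moreover have "star w = w" using q by (simp add: w_def star_linear star_positive_cone)
  ultimately have "1 *\<^sub>R jone - w \<odot> w \<in> positive_cone"
    by (intro norm_bound_minus_positive) (simp_all add: star_jprod)
  then have "(1/4) *\<^sub>R (1 *\<^sub>R jone - w \<odot> w) \<in> positive_cone" by (rule positive_cone_scaleR) simp
  moreover have "1 *\<^sub>R jone - w \<odot> w = 4 *\<^sub>R (q - q \<odot> q)"
    using scaleR_add_left[of 2 2 "q - q \<odot> q"] by (simp add: w_def jprod_linear scaleR_2)
  ultimately show ?thesis by simp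
qed


section \<open>The square of an element lies in its double sphere\<close>

lemma positive_unit_sphereD:
  assumes "x \<in> positive_unit_sphere"
  shows "x \<in> positive_cone" "norm x = 1"
  using assms by (auto simp: positive_unit_sphere_def)

lemma jone_minus_positive:
  fixes x :: "'a::unital_jb_star_algebra"
  assumes "x \<in> positive_cone" "norm x \<le> 1" shows "jone - x \<in> positive_cone"
  using norm_bound_minus_positive[of x 1] assms by (simp add: star_positive_cone)

lemma norm_diff_positive_le:
  fixes a b :: "'a::unital_jb_star_algebra"
  assumes "a \<in> positive_cone" "norm a \<le> 1" "b \<in> positive_cone" "norm b \<le> 1"
  shows "norm (a - b) \<le> 1"
proof (rule norm_le_interval)
  show "1 *\<^sub>R jone + (a - b) \<in> positive_cone"
    using positive_cone_add[OF assms(1) jone_minus_positive[OF assms(3,4)]] by (simp add: algebra_simps)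
  show "1 *\<^sub>R jone - (a - b) \<in> positive_cone"
    using positive_cone_add[OF assms(3) jone_minus_positive[OF assms(1,2)]] by (simp add: algebra_simps)
qed simp

lemma norm_cube_le:
  fixes a :: "'a::jb_star_algebra"
  assumes "star a = a"
  shows "norm a ^ 3 \<le> norm (a \<odot> a) * norm a"
  using norm_jprod_le[of "a \<odot> a" a] U_op_star_self_adjoint[OF assms] by simp

text \<open>
  If \<open>-t \<le> p\<^sup>2 - x \<le> t\<close> with \<open>t < 1\<close>, then \<open>p\<^sup>2 \<le> p\<close> bounds \<open>x - p\<close> above by \<open>t\<close>, and
  \<open>2p \<le> 1 + p\<^sup>2\<close> together with \<open>x \<ge> 0\<close> bounds \<open>p - x\<close> above by \<open>(1 + t)/2\<close>. So the distance of \<open>x\<close>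
  from \<open>p\<close> is less than one.
\<close>

lemma square_mem_double_sphere:
  fixes p :: "'a::unital_jb_star_algebra"
  assumes p: "p \<in> positive_cone" "norm p = 1"
  shows "p \<odot> p \<in> Sph positive_unit_sphere (Sph positive_unit_sphere {p})"
proof -
  have sp: "star p = p" by (rule star_positive_cone[OF p(1)])
  have pp: "p \<odot> p \<in> positive_cone" by (rule square_in_positive_cone[OF sp])
  have n: "norm (p \<odot> p) = 1"
    using norm_jprod_le[of p p] norm_cube_le[OF sp] p by simp
  have "norm (p \<odot> p - x) = 1" if x: "x \<in> positive_unit_sphere" "norm (x - p) = 1" for x
  proof (rule antisym)
    note x' = positive_unit_sphereD[OF x(1)]
    show "norm (p \<odot> p - x) \<le> 1"
      by (rule norm_diff_positive_le) (use pp n x' in auto)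
    define t where "t = norm (p \<odot> p - x)"
    have st: "star (p \<odot> p - x) = p \<odot> p - x" "star (x - p \<odot> p) = x - p \<odot> p"
      using pp x' by (simp_all add: star_linear star_positive_cone)
    have A: "t *\<^sub>R jone - (p \<odot> p - x) \<in> positive_cone" "t *\<^sub>R jone - (x - p \<odot> p) \<in> positive_cone"
      by (rule norm_bound_minus_positive; simp add: st t_def norm_minus_commute)+
    show "1 \<le> norm (p \<odot> p - x)"
    proof (rule ccontr)
      assume "\<not> 1 \<le> norm (p \<odot> p - x)"
      then have t1: "t < 1" by (simp add: t_def)
      have "norm (x - p) \<le> (1 + t) / 2"
      proof (rule norm_le_interval)
        have "((1 - t) / 2) *\<^sub>R jone + (t *\<^sub>R jone - (x - p \<odot> p)) + (p - p \<odot> p) \<in> positive_cone"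
          using t1 p
          by (intro positive_cone_add A square_le_self positive_cone_scaleR
              projection_in_positive_cone[OF is_projection_jone]) auto
        also have "((1 - t) / 2) *\<^sub>R jone + (t *\<^sub>R jone - (x - p \<odot> p)) + (p - p \<odot> p)
          = ((1 + t) / 2) *\<^sub>R jone - (x - p)"
        proof -
          have "((1 - t) / 2) *\<^sub>R jone + t *\<^sub>R jone = ((1 + t) / 2) *\<^sub>R (jone::'a)"
            by (simp add: field_simps flip: scaleR_add_left)
          then show ?thesis by (simp add: algebra_simps)
        qed
        finally show "((1 + t) / 2) *\<^sub>R jone - (x - p) \<in> positive_cone" .
      next
        have "star (jone - p) = jone - p" by (simp add: star_linear sp)
        then have "(1/2) *\<^sub>R ((t *\<^sub>R jone - (p \<odot> p - x)) + x + (jone - p) \<odot> (jone - p)) \<in> positive_cone"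
          by (intro positive_cone_add A x' positive_cone_scaleR square_in_positive_cone) auto
        also have "(t *\<^sub>R jone - (p \<odot> p - x)) + x + (jone - p) \<odot> (jone - p)
          = (1 + t) *\<^sub>R jone + 2 *\<^sub>R (x - p)"
          by (simp add: jprod_linear scaleR_2 algebra_simps)
        also have "(1/2) *\<^sub>R \<dots> = ((1 + t) / 2) *\<^sub>R jone + (x - p)"
          by (simp add: scaleR_add_right)
        finally show "((1 + t) / 2) *\<^sub>R jone + (x - p) \<in> positive_cone" .
      next
        show "0 \<le> (1 + t) / 2" by (simp add: t_def)
      qed
      then show False using x t1 by simp
    qed
  qed
  then show ?thesis using pp n by (auto simp: Sph_def positive_unit_sphere_def)
qed

section \<open>The double sphere of a projection\<close>

text \<open>
  The upper bound \<open>q - (1 + y)/2 \<le> 1/2\<close> is immediate. For the lower one, the half component \<open>z\<close> of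
  \<open>q\<close> is controlled by completing a square, \<open>(l p + z/l)\<^sup>2 = l\<^sup>2 p + z + z\<^sup>2/l\<^sup>2\<close>, which plays the
  role of the Cauchy-Schwarz inequality: \<open>z\<close> is bounded below by a large multiple of \<open>-p\<close> and a
  small multiple of \<open>-1\<close>. The small multiple is absorbed by \<open>c y\<close> and the gap \<open>1 - p - y\<close>. The
  large multiple is absorbed by the \<open>p/2\<close> available in \<open>1 - (1 + y)/2\<close>, after \<open>q\<close> is replaced by
  the smaller element \<open>\<theta> q\<close>.
\<close>

lemma norm_diff_lt_one:
  fixes p q y :: "'a::unital_jb_star_algebra" and c :: real
  assumes p: "is_projection p" and q: "q \<in> positive_cone" "norm q \<le> 1"
    and c: "0 < c" and y: "corner (jone - p) q = c *\<^sub>R y"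
    and y0: "y \<in> positive_cone" and ry: "jone - p - y \<in> positive_cone"
  shows "norm (q - (1/2) *\<^sub>R (jone + y)) < 1"
proof -
  define z where "z = off_corner p q"
  define a where "a = corner p q"
  have sp: "star p = p" "p \<odot> p = p" using p by (simp_all add: is_projection_def)
  have sq: "star q = q" by (rule star_positive_cone[OF q(1)])
  have z: "star z = z" "p \<odot> z = (1/2) *\<^sub>R z"
    using p sq by (simp_all add: z_def star_corner jprod_off_corner)
  have qd: "q = a + z + c *\<^sub>R y"
    unfolding a_def z_def y[symmetric] by (simp add: peirce_decomposition)
  have a0: "a \<in> positive_cone" unfolding a_def by (rule corner_positive[OF p q(1)])
  \<comment> \<open>\<open>\<kappa>\<close> makes the multiple \<open>M / \<kappa>\<close> of the unit equal to \<open>c/2\<close>, half of what \<open>c y\<close> offers;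
    \<open>\<theta>\<close> is so small that \<open>\<theta> \<kappa> + \<theta> c \<le> 1/2\<close>.\<close>
  define M where "M = norm (z \<odot> z) + 1"
  define \<kappa> where "\<kappa> = 2 * M / c"
  define l where "l = sqrt \<kappa>"
  define \<theta> where "\<theta> = 1 / (2 * (\<kappa> + c) + 1)"
  have M: "M > 0" by (simp add: M_def add_nonneg_pos)
  have \<kappa>: "\<kappa> > 0" and kc: "M / \<kappa> = c / 2" using M c by (simp_all add: \<kappa>_def)
  have l: "l > 0" "l * l = \<kappa>" using \<kappa> by (simp_all add: l_def)
  have \<theta>: "\<theta> > 0" "\<theta> \<le> 1" using \<kappa> c by (simp_all add: \<theta>_def)
  have "\<theta> * (2 * (\<kappa> + c) + 1) = 1" using \<kappa> c by (simp add: \<theta>_def)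
  then have \<theta>2: "\<theta> * \<kappa> + \<theta> * c \<le> 1/2" using \<theta> by (simp add: algebra_simps)
  have pos: "\<theta> * \<kappa> > 0" "\<theta> * c > 0" using \<theta> \<kappa> c by simp_all
  then have \<theta>c: "\<theta> * c \<le> 1/2" using \<theta>2 by linarith
  define s where "s = l *\<^sub>R p + (1/l) *\<^sub>R z"
  have ss: "s \<odot> s = \<kappa> *\<^sub>R p + z + (1/\<kappa>) *\<^sub>R (z \<odot> z)"
  proof -
    have "s \<odot> s = (l * l) *\<^sub>R p + 2 *\<^sub>R (p \<odot> z) + (1 / (l * l)) *\<^sub>R (z \<odot> z)"
      using l jprod_commute[of z p] by (simp add: s_def jprod_linear sp scaleR_2 algebra_simps)
    then show ?thesis by (simp add: l z)
  qed
  define b where "b = M *\<^sub>R jone - z \<odot> z"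
  have b0: "b \<in> positive_cone"
    unfolding b_def by (rule norm_bound_minus_positive) (simp_all add: star_jprod z M_def)
  have s0: "s \<odot> s \<in> positive_cone"
    by (rule square_in_positive_cone) (simp add: s_def star_linear sp z)
  have zeq: "z = s \<odot> s + (1/\<kappa>) *\<^sub>R b - \<kappa> *\<^sub>R p - (c/2) *\<^sub>R jone"
    using kc by (simp add: ss b_def algebra_simps)
  have one: "jone \<in> positive_cone" by (rule projection_in_positive_cone[OF is_projection_jone])
  define \<delta> where "\<delta> = \<theta> * c / 2"
  have "norm (q - (1/2) *\<^sub>R (jone + y)) \<le> 1 - \<delta>"
  proof (rule norm_le_interval)
    have "(jone - q) + (1/2) *\<^sub>R y + (1/2 - \<delta>) *\<^sub>R jone \<in> positive_cone"
      using pos \<theta>2 by (intro positive_cone_add positive_cone_scaleR one y0 jone_minus_positive q)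
        (auto simp: \<delta>_def)
    also have "(jone - q) + (1/2) *\<^sub>R y + (1/2 - \<delta>) *\<^sub>R jone
        = (1 - \<delta>) *\<^sub>R jone - (q - (1/2) *\<^sub>R (jone + y))"
      by (simp add: algebra_simps)
    finally show "(1 - \<delta>) *\<^sub>R jone - (q - (1/2) *\<^sub>R (jone + y)) \<in> positive_cone" .
  next
    define r where "r = jone - p - y"
    define w where "w = (1 - \<theta>) *\<^sub>R q + \<theta> *\<^sub>R a + \<theta> *\<^sub>R (s \<odot> s) + (\<theta> / \<kappa>) *\<^sub>R b
        + (1/2 - \<theta> * c) *\<^sub>R r + (1/2 - \<theta> * \<kappa> - \<theta> * c) *\<^sub>R p"
    have "w \<in> positive_cone"
      unfolding w_def
      using pos \<theta> \<theta>2 \<theta>c \<kappa> ry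
      by (intro positive_cone_add positive_cone_scaleR q a0 s0 b0
          projection_in_positive_cone[OF p]) (auto simp: r_def)
    moreover have "w = (1 - \<delta>) *\<^sub>R jone + (q - (1/2) *\<^sub>R (jone + y))"
    proof -
      have "\<theta> *\<^sub>R q = \<theta> *\<^sub>R a + \<theta> *\<^sub>R z + (\<theta> * c) *\<^sub>R y"
        by (subst qd) (simp add: scaleR_add_right)
      moreover have "\<theta> *\<^sub>R z = \<theta> *\<^sub>R (s \<odot> s) + (\<theta> / \<kappa>) *\<^sub>R b - (\<theta> * \<kappa>) *\<^sub>R p - \<delta> *\<^sub>R jone"
        by (subst zeq) (simp add: algebra_simps \<delta>_def)
      ultimately have "w = q - (\<theta> * c) *\<^sub>R y + (\<theta> * \<kappa>) *\<^sub>R p + \<delta> *\<^sub>R jone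
        + (1/2 - \<theta> * c) *\<^sub>R r + (1/2 - \<theta> * \<kappa> - \<theta> * c) *\<^sub>R p"
        by (simp add: w_def algebra_simps)
      also have "\<dots> = q + \<delta> *\<^sub>R jone + (1/2 - \<theta> * c) *\<^sub>R (r + p) - (\<theta> * c) *\<^sub>R y"
        by (simp add: algebra_simps)
      also have "r + p = jone - y" by (simp add: r_def)
      also have "q + \<delta> *\<^sub>R jone + (1/2 - \<theta> * c) *\<^sub>R (jone - y) - (\<theta> * c) *\<^sub>R y
        = q + (\<delta> - \<theta> * c + 1/2) *\<^sub>R jone - (1/2) *\<^sub>R y"
        by (simp add: algebra_simps)
      also have "\<delta> - \<theta> * c + 1/2 = (1 - \<delta>) - 1/2" by (simp add: \<delta>_def)
      also have "((1 - \<delta>) - 1/2) *\<^sub>R jone = (1 - \<delta>) *\<^sub>R jone - (1/2) *\<^sub>R (jone::'a)"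
        by (rule scaleR_diff_left)
      finally show ?thesis by (simp add: algebra_simps)
    qed
    ultimately show "(1 - \<delta>) *\<^sub>R jone + (q - (1/2) *\<^sub>R (jone + y)) \<in> positive_cone"
      by simp
  next
    show "0 \<le> 1 - \<delta>" using pos \<theta>2 by (simp add: \<delta>_def)
  qed
  then show ?thesis using pos by (simp add: \<delta>_def)
qed

text \<open>
  The test element \<open>x = (1 + y)/2\<close>, with \<open>y\<close> the normalised component of \<open>q\<close> under \<open>r = 1 - p\<close>, is
  at distance one from \<open>p\<close>: the component of \<open>x - p\<close> under \<open>r\<close> is \<open>(r + y)/2 \<ge> y\<close>. It is too close
  to \<open>q\<close> by \<open>norm_diff_lt_one\<close>.
\<close>

lemma corner_complement_zero:
  fixes p q :: "'a::unital_jb_star_algebra"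
  assumes p: "is_projection p" and q: "q \<in> positive_cone" "norm q \<le> 1"
    and dist: "\<And>x. x \<in> Sph positive_unit_sphere {p} \<Longrightarrow> norm (q - x) = 1"
  shows "corner (jone - p) q = 0"
proof (rule ccontr)
  define r where "r = jone - p"
  have r: "is_projection r" unfolding r_def by (rule is_projection_complement[OF p])
  have sp: "star p = p" "p \<odot> p = p" using p by (simp_all add: is_projection_def)
  assume "corner (jone - p) q \<noteq> 0"
  then have c: "norm (corner r q) > 0" by (simp add: r_def)
  define y where "y = (1 / norm (corner r q)) *\<^sub>R corner r q"
  have qy: "corner r q = norm (corner r q) *\<^sub>R y" using c by (simp add: y_def)
  have y: "y \<in> positive_cone" "norm y = 1"
    using c r q by (simp_all add: y_def positive_cone_scaleR corner_positive)
  have ry: "r \<odot> y = y" by (simp add: y_def jprod_linear jprod_corner[OF r])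
  have ry0: "r - y \<in> positive_cone"
    by (rule positive_cone_corner[OF r, where t = 1])
      (use y r in \<open>simp_all add: star_linear star_positive_cone jprod_linear ry is_projection_def\<close>)
  define x where "x = (1/2) *\<^sub>R (jone + y)"
  have "norm (2 *\<^sub>R y) \<le> norm (r + y)"
    by (rule positive_norm_mono) (use y ry0 in \<open>simp_all add: positive_cone_add scaleR_2\<close>)
  then have n: "1 \<le> norm ((1/2) *\<^sub>R (r + y))" using y by simp
  have rn: "1 \<le> norm a" if "r \<odot> a = (1/2) *\<^sub>R (r + y)" for a
  proof -
    have "norm (r \<odot> a) \<le> norm r * norm a" by (rule norm_jprod_le)
    also have "\<dots> \<le> 1 * norm a" by (intro mult_right_mono norm_projection_le r) simp
    finally show ?thesis using n that by simp
  qed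
  have rp: "r \<odot> p = 0" by (simp add: r_def jprod_linear sp)
  have x0: "x \<in> positive_cone"
    unfolding x_def
    by (intro positive_cone_scaleR positive_cone_add y
        projection_in_positive_cone[OF is_projection_jone]) simp
  have x1: "norm x = 1"
  proof (rule antisym)
    have "norm (jone + y) \<le> 1 + 1" by (rule norm_triangle_mono[OF norm_jone_le]) (simp add: y)
    then show "norm x \<le> 1" by (simp add: x_def del: scaleR_add_right)
    show "1 \<le> norm x" by (rule rn) (simp add: x_def jprod_linear ry)
  qed
  have "norm (x - p) = 1"
  proof (rule antisym)
    show "norm (x - p) \<le> 1"
      by (rule norm_diff_positive_le)
        (use x0 x1 p in \<open>simp_all add: projection_in_positive_cone norm_projection_le\<close>)
    show "1 \<le> norm (x - p)" by (rule rn) (simp add: x_def jprod_linear ry rp)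
  qed
  then have "norm (q - x) = 1"
    using x0 x1 by (intro dist) (simp add: Sph_def positive_unit_sphere_def)
  moreover have "norm (q - x) < 1"
    unfolding x_def
    by (rule norm_diff_lt_one[OF p q c]) (use qy y ry0 in \<open>simp_all add: r_def\<close>)
  ultimately show False by simp
qed

lemma positive_antisym:
  fixes a :: "'a::unital_jb_star_algebra"
  assumes "a \<in> positive_cone" "- a \<in> positive_cone" shows "a = 0"
  using norm_le_interval[of 0 a] assms by simp

text \<open>
  The component of \<open>q\<^sup>2 \<le> q\<close> under \<open>1 - p\<close> is that of \<open>z\<^sup>2\<close>; it is squeezed between \<open>0\<close> and \<open>0\<close>,
  so \<open>p \<odot> z\<^sup>2 = z\<^sup>2\<close>. The Jordan identity \<open>(p \<odot> z) \<odot> z\<^sup>2 = (p \<odot> z\<^sup>2) \<odot> z\<close> then reads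
  \<open>z\<^sup>3/2 = z\<^sup>3\<close>.
\<close>

lemma off_corner_zero:
  fixes p q :: "'a::unital_jb_star_algebra"
  assumes p: "is_projection p" and q: "q \<in> positive_cone" "norm q \<le> 1"
    and q0: "corner (jone - p) q = 0"
  shows "off_corner p q = 0"
proof -
  define z where "z = off_corner p q"
  define r where "r = jone - p"
  have r: "is_projection r" unfolding r_def by (rule is_projection_complement[OF p])
  have sq: "star q = q" by (rule star_positive_cone[OF q(1)])
  have z: "star z = z" "p \<odot> z = (1/2) *\<^sub>R z"
    using p sq by (simp_all add: z_def star_corner jprod_off_corner)
  have eq: "corner r (q \<odot> q) = r \<odot> (z \<odot> z)"
    using q0 unfolding corner_square[OF r] by (simp add: r_def off_corner_complement z_def jprod_linear)
  have "corner r (q - q \<odot> q) \<in> positive_cone"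
    by (rule corner_positive[OF r square_le_self[OF q]])
  then have "- corner r (q \<odot> q) \<in> positive_cone" using q0 by (simp add: corner_linear r_def)
  then have "corner r (q \<odot> q) = 0"
    by (intro positive_antisym corner_positive[OF r] square_in_positive_cone sq)
  then have "p \<odot> (z \<odot> z) = z \<odot> z" using eq by (simp add: r_def jprod_linear)
  then have "(1/2) *\<^sub>R ((z \<odot> z) \<odot> z) = (z \<odot> z) \<odot> z"
    using jordan_identity[of p z] z jprod_commute[of z "z \<odot> z"] by (simp add: jprod_linear)
  then have "(z \<odot> z) \<odot> z = 0"
    using scaleR_cancel_right[of "1/2" "(z \<odot> z) \<odot> z" 1] by simp
  then show ?thesis using U_op_star_self_adjoint[OF z(1)] by (simp add: z_def)
qed

text \<open>
  Among the affine functions of \<open>q\<close>, \<open>x = p - b / norm b\<close> with \<open>b = p - q\<close> is the one that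
  stretches the spectrum of \<open>q\<close> relative to \<open>p\<close>, with lowest point \<open>1 - norm b\<close> and highest point
  \<open>1\<close>, to have lowest point \<open>0\<close> and highest point \<open>1\<close>. So \<open>x\<close> has norm one, is at distance one
  from \<open>p\<close>, and moves \<open>q\<close> by \<open>1 - norm b\<close> only.
\<close>

lemma eq_of_corner:
  fixes p q :: "'a::unital_jb_star_algebra"
  assumes p: "is_projection p" "norm p = 1" and q: "q \<in> positive_cone" "norm q = 1"
    and pq: "p \<odot> q = q"
    and dist: "\<And>x. x \<in> Sph positive_unit_sphere {p} \<Longrightarrow> norm (q - x) = 1"
  shows "q = p"
proof (rule ccontr)
  assume "q \<noteq> p"
  define \<beta> where "\<beta> = norm (p - q)"
  have \<beta>0: "\<beta> > 0" using \<open>q \<noteq> p\<close> by (simp add: \<beta>_def)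
  have sp: "star p = p" "p \<odot> p = p" using p by (simp_all add: is_projection_def)
  have sq: "star q = q" by (rule star_positive_cone[OF q(1)])
  have b: "p - q \<in> positive_cone"
    by (rule positive_cone_corner[OF p(1), where t = 1])
      (use q in \<open>simp_all add: star_linear sp sq jprod_linear pq\<close>)
  have "norm (p - q) \<le> norm p" by (rule positive_norm_mono[OF b]) (simp add: q)
  then have \<beta>1: "\<beta> \<le> 1" by (simp add: \<beta>_def p)
  define x where "x = p - (1/\<beta>) *\<^sub>R (p - q)"
  have x0: "x \<in> positive_cone"
    by (rule positive_cone_corner[OF p(1), where t = 1])
      (use \<beta>0 in \<open>simp_all add: x_def star_linear sp sq jprod_linear pq \<beta>_def flip: scaleR_diff_right\<close>)
  have "norm x \<le> norm p"
    by (rule positive_norm_mono[OF x0]) (use \<beta>0 b in \<open>simp add: x_def positive_cone_scaleR del: scaleR_diff_right\<close>)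
  moreover have "1 \<le> norm x"
  proof -
    have "q = \<beta> *\<^sub>R x + (1 - \<beta>) *\<^sub>R p" using \<beta>0 by (simp add: x_def algebra_simps)
    then have "norm q \<le> norm (\<beta> *\<^sub>R x) + norm ((1 - \<beta>) *\<^sub>R p)" using norm_triangle_ineq by metis
    then have "1 \<le> \<beta> * norm x + (1 - \<beta>)" using \<beta>0 \<beta>1 p q by simp
    then show ?thesis using \<beta>0 by simp
  qed
  ultimately have x1: "norm x = 1" using p by simp
  have "norm (x - p) = 1"
    using \<beta>0 by (simp add: x_def \<beta>_def del: scaleR_diff_right)
  then have "norm (q - x) = 1"
    using x0 x1 by (intro dist) (simp add: Sph_def positive_unit_sphere_def)
  have "q - x = (1/\<beta> - 1) *\<^sub>R (p - q)" by (simp add: x_def algebra_simps)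
  then have "norm (q - x) = \<bar>1/\<beta> - 1\<bar> * \<beta>" by (simp add: \<beta>_def)
  moreover have "\<bar>1/\<beta> - 1\<bar> = 1/\<beta> - 1" using \<beta>0 \<beta>1 by simp
  moreover have "(1/\<beta> - 1) * \<beta> = 1 - \<beta>" using \<beta>0 by (simp add: left_diff_distrib)
  ultimately have "norm (q - x) = 1 - \<beta>" by simp
  then show False using \<beta>0 \<open>norm (q - x) = 1\<close> by simp
qed

theorem theorem3p6:
  fixes p :: "'a::unital_jb_star_algebra"
  assumes "p \<in> positive_cone" and "norm p = 1"
  shows "is_projection p \<longleftrightarrow>
    Sph positive_unit_sphere (Sph positive_unit_sphere {p}) = {p}"
proof
  assume "Sph positive_unit_sphere (Sph positive_unit_sphere {p}) = {p}"
  then have "p \<odot> p = p" using square_mem_double_sphere[OF assms] by simp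
  then show "is_projection p"
    using assms(1) by (simp add: is_projection_def star_positive_cone)
next
  assume p: "is_projection p"
  show "Sph positive_unit_sphere (Sph positive_unit_sphere {p}) = {p}"
  proof
    show "{p} \<subseteq> Sph positive_unit_sphere (Sph positive_unit_sphere {p})"
      using assms by (simp add: Sph_def positive_unit_sphere_def norm_minus_commute[of p])
    show "Sph positive_unit_sphere (Sph positive_unit_sphere {p}) \<subseteq> {p}"
    proof
      fix q assume "q \<in> Sph positive_unit_sphere (Sph positive_unit_sphere {p})"
      then have q: "q \<in> positive_cone" "norm q = 1"
        and dist: "\<And>x. x \<in> Sph positive_unit_sphere {p} \<Longrightarrow> norm (q - x) = 1"
        by (auto simp: Sph_def positive_unit_sphere_def)
      have q0: "corner (jone - p) q = 0"
        by (rule corner_complement_zero[OF p q(1)]) (use q dist in auto)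
      have "off_corner p q = 0" by (rule off_corner_zero[OF p q(1) _ q0]) (simp add: q)
      then have "corner p q = q" using peirce_decomposition[of p q] q0 by simp
      then have "p \<odot> q = q" by (metis jprod_corner[OF p])
      then show "q \<in> {p}" using eq_of_corner[OF p assms(2) q] dist by simp
    qed
  qed
qed

end
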